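(* Let $B(\mathrm{G},f,[1,h]_{\mathbb{N}})$ be a Boolean network with dependency graph $\mathrm{G}$, node dynamics $f=(f_1,\dots,f_n)$ and directly observable nodes $1,\dots,h$. Then $B(\mathrm{G},f,[1,h]_{\mathbb{N}})$ is structurally observable if and only if $\mathrm{G}$ (with vertices $v_1,\dots,v_h$ directly observable) satisfies both Property $P_1$ and Property $P_2$.
   Context: A Boolean network with $n$ nodes and $h\le n$ directly observable nodes is a system $x_i[k+1]=f_i((x_j[k])_{j\in\mathbf{N}_i})$, $i=1,\dots,n$, $y_p[k]=x_p[k]$, $p=1,\dots,h$, $k=0,1,2,\dots$, with $x_i[k]\in\{0,1\}$, $\mathbf{N}_i\subseteq\{1,\dots,n\}$, and each $f_i:\{0,1\}^{|\mathbf{N}_i|}\to\{0,1\}$ a minimally represented logical function (i.e. $f_i$ depends essentially on each of its arguments; it is a constant if $\mathbf{N}_i=\emptyset$). Its dependency graph is the digraph $\mathrm{G}=(\mathrm{V},\mathrm{E})$, $\mathrm{V}=\{v_1,\dots,v_n\}$, in which the in-neighbors of $v_i$ are exactly the $v_j$ with $j\in\mathbf{N}_i$, i.e. $(v_j,v_i)\in\mathrm{E}$ iff $j\in\mathbf{N}_i$ (self-loops allowed). The network is denoted $B(\mathrm{G},f,[1,h]_{\mathbb{N}})$. The network is observable if for any two distinct initial states in $\{0,1\}^n$ at $k=0$ the corresponding output trajectories differ at some time $k\ge 0$. Two Boolean networks $B(\mathrm{G},f,[1,h]_{\mathbb{N}})$ and $B(\hat{\mathrm{G}},\hat f,[1,h]_{\mathbb{N}})$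 are structurally equivalent if $\hat{\mathrm{G}}=\mathrm{G}$ (same vertices, same edges). A Boolean network is structurally observable if all Boolean networks structurally equivalent to it are observable. Vertices $v_1,\dots,v_h$ are called directly observable; the others are called simple. A cycle is a closed walk along directed edges without repeated vertices other than start = end (a self-loop is a cycle). Property $P_1$: for every simple vertex $v$ there is a vertex $v'$ whose unique in-neighbor is $v$. Property $P_2$: for every cycle $C$ consisting entirely of simple vertices there is a vertex $v\notin C$ whose unique in-neighbor is some vertex $v'\in C$. *)

theory Defs
  imports "HOL-Library.FuncSet" "Graph_Theory.Pair_Digraph"
begin

text \<open>
  Nodes are the numbers \<open>1, \<dots>, n\<close> and Boolean values are of type \<^typ>\<open>bool\<close>. A vector in
  \<open>{0,1}\<^sup>A\<close> is an extensional function, i.e. an element of \<open>A \<rightarrow>\<^sub>E UNIV\<close>. The update function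
  of node \<open>i\<close> is meaningful only on \<open>nbrs B i \<rightarrow>\<^sub>E UNIV\<close>, and \<open>nbrs\<close> and \<open>dyn\<close> only for
  \<open>i \<in> {1..n}\<close>; no definition below looks at other values.
\<close>

record bool_net =
  nnodes :: nat
  nobs :: nat
  nbrs :: "nat \<Rightarrow> nat set"
  dyn :: "nat \<Rightarrow> (nat \<Rightarrow> bool) \<Rightarrow> bool"

definition nodes :: "bool_net \<Rightarrow> nat set" where
  "nodes B = {1..nnodes B}"

definition obs_nodes :: "bool_net \<Rightarrow> nat set" where
  "obs_nodes B = {1..nobs B}"

definition depends_on :: "nat set \<Rightarrow> ((nat \<Rightarrow> bool) \<Rightarrow> bool) \<Rightarrow> nat \<Rightarrow> bool" where
  "depends_on A g j \<longleftrightarrow>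
     (\<exists>z \<in> A \<rightarrow>\<^sub>E UNIV. \<exists>z' \<in> A \<rightarrow>\<^sub>E UNIV. (\<forall>l \<in> A - {j}. z l = z' l) \<and> g z \<noteq> g z')"

definition minimally_represented :: "nat set \<Rightarrow> ((nat \<Rightarrow> bool) \<Rightarrow> bool) \<Rightarrow> bool" where
  "minimally_represented A g \<longleftrightarrow> (\<forall>j \<in> A. depends_on A g j)"

definition boolean_network :: "bool_net \<Rightarrow> bool" where
  "boolean_network B \<longleftrightarrow>
     nobs B \<le> nnodes B \<and>
     (\<forall>i \<in> nodes B. nbrs B i \<subseteq> nodes B \<and> minimally_represented (nbrs B i) (dyn B i))"

definition dependency_graph :: "bool_net \<Rightarrow> nat pair_pre_digraph" where
  "dependency_graph B =
     \<lparr> pverts = nodes B, parcs = {(j, i). i \<in> nodes B \<and> j \<in> nbrs B i} \<rparr>"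

definition states :: "bool_net \<Rightarrow> (nat \<Rightarrow> bool) set" where
  "states B = nodes B \<rightarrow>\<^sub>E UNIV"

definition step :: "bool_net \<Rightarrow> (nat \<Rightarrow> bool) \<Rightarrow> (nat \<Rightarrow> bool)" where
  "step B x = (\<lambda>i\<in>nodes B. dyn B i (restrict x (nbrs B i)))"

definition trajectory :: "bool_net \<Rightarrow> (nat \<Rightarrow> bool) \<Rightarrow> nat \<Rightarrow> (nat \<Rightarrow> bool)" where
  "trajectory B x k = (step B ^^ k) x"

definition output_at :: "bool_net \<Rightarrow> (nat \<Rightarrow> bool) \<Rightarrow> nat \<Rightarrow> (nat \<Rightarrow> bool)" where
  "output_at B x k = restrict (trajectory B x k) (obs_nodes B)"

definition observable :: "bool_net \<Rightarrow> bool" where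
  "observable B \<longleftrightarrow>
     (\<forall>x \<in> states B. \<forall>x' \<in> states B. x \<noteq> x' \<longrightarrow> (\<exists>k. output_at B x k \<noteq> output_at B x' k))"

definition structurally_equivalent :: "bool_net \<Rightarrow> bool_net \<Rightarrow> bool" where
  "structurally_equivalent B B' \<longleftrightarrow>
     dependency_graph B' = dependency_graph B \<and> nobs B' = nobs B"

definition structurally_observable :: "bool_net \<Rightarrow> bool" where
  "structurally_observable B \<longleftrightarrow>
     (\<forall>B'. boolean_network B' \<and> structurally_equivalent B B' \<longrightarrow> observable B')"

definition in_neighbors :: "'a pair_pre_digraph \<Rightarrow> 'a \<Rightarrow> 'a set" where
  "in_neighbors G v = {u. u \<rightarrow>\<^bsub>G\<^esub> v}"

text \<open>
  In the following two properties \<open>D\<close> is the set of directly observable vertices. In the first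
  one \<open>v' = v\<close> is allowed (a self-loop). In the second one a cycle is a list \<open>p\<close> of arcs
  (self-loops included), so that its vertices are the tails of the arcs in \<open>p\<close>.
\<close>

definition property_P1 :: "'a pair_pre_digraph \<Rightarrow> 'a set \<Rightarrow> bool" where
  "property_P1 G D \<longleftrightarrow>
     (\<forall>v \<in> pverts G - D. \<exists>v' \<in> pverts G. in_neighbors G v' = {v})"

definition property_P2 :: "'a pair_pre_digraph \<Rightarrow> 'a set \<Rightarrow> bool" where
  "property_P2 G D \<longleftrightarrow>
     (\<forall>p. pre_digraph.cycle G p \<and> fst ` set p \<subseteq> pverts G - D \<longrightarrow>
        (\<exists>v \<in> pverts G - fst ` set p. \<exists>v' \<in> fst ` set p. in_neighbors G v = {v'}))"

end

theory Submission
  imports Defs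
begin

text \<open>
  Say that \<open>u\<close> determines \<open>w\<close> if \<open>u\<close> is the only in-neighbor of \<open>w\<close>; then, in every network on the
  graph, a difference at \<open>u\<close> propagates to \<open>w\<close> in one step. Given \<open>P\<^sub>1\<close> and \<open>P\<^sub>2\<close>, every vertex is
  connected to a directly observable one by a chain of such pairs. Indeed, \<open>P\<^sub>1\<close> yields a map sending
  each vertex without a chain to a vertex without a chain that it determines. This map is injective,
  hence a permutation, and its cycles violate \<open>P\<^sub>2\<close>. Conversely, if \<open>P\<^sub>1\<close> fails at \<open>v\<close>, then with
  conjunctions at all nodes the zero state and the indicator of \<open>v\<close> have the same successor. If
  \<open>P\<^sub>2\<close> fails at \<open>C\<close>, one can choose the node dynamics such that the all-ones state and the indicator
  of the complement of \<open>C\<close> are both fixed points.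
\<close>

section \<open>Determination chains and cycles in a digraph\<close>

definition determines :: "'a pair_pre_digraph \<Rightarrow> 'a \<Rightarrow> 'a \<Rightarrow> bool" where
  "determines G u w \<longleftrightarrow> w \<in> pverts G \<and> in_neighbors G w = {u}"

lemma mem_in_neighbors_iff: "u \<in> in_neighbors G v \<longleftrightarrow> (u, v) \<in> parcs G"
  by (simp add: in_neighbors_def arcs_ends_def arc_to_ends_def image_iff)

lemma determines_arc: "determines G u w \<Longrightarrow> (u, w) \<in> parcs G"
  using mem_in_neighbors_iff[of u G w] by (simp add: determines_def)

lemma determines_unique: "determines G u w \<Longrightarrow> determines G u' w \<Longrightarrow> u = u'"
  by (auto simp: determines_def)

text \<open>An orbit of \<open>s\<close> is a walk. The arbitrary starting index \<open>k\<close>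
  serves the induction, which splits off the first arc.\<close>

lemma cas_funpow:
  "pcas ((s ^^ k) v)
     (map (\<lambda>i. ((s ^^ i) v, (s ^^ Suc i) v)) [k..<k + m]) ((s ^^ (k + m)) v)"
proof (induction m arbitrary: k)
  case 0
  then show ?case by simp
next
  case (Suc m)
  have "[k..<k + Suc m] = k # [Suc k..<Suc k + m]"
    by (simp add: upt_conv_Cons)
  then show ?case
    using Suc.IH[of "Suc k"] by simp
qed

text \<open>Each tail on a closed walk is also the head of the preceding arc, which for the starting
  vertex is the last arc of \<open>p\<close>.\<close>

lemma cycle_vertex_has_pred:
  assumes "pre_digraph.cycle (with_proj G) p" "v \<in> fst ` set p"
  shows "\<exists>u \<in> fst ` set p. (u, v) \<in> parcs G"
proof -
  have cas_pred: "v = u \<or> v \<in> snd ` set q"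
    if "pcas u q w" "v \<in> fst ` set q" for u q w
    using that
  proof (induction q arbitrary: u)
    case (Cons e q)
    then show ?case by auto
  qed simp
  have cas_last: "w \<in> snd ` set q"
    if "pcas u q w" "q \<noteq> []" for u w :: 'a and q
    using that
  proof (induction q arbitrary: u)
    case (Cons e q)
    then show ?case by (cases q) auto
  qed simp
  obtain u where "pcas u p u" "p \<noteq> []" "set p \<subseteq> parcs G"
    using assms(1) by (auto simp: pre_digraph.cycle_def pre_digraph.awalk_def cas_with_proj_eq)
  then have "v \<in> snd ` set p"
    using cas_pred[of u p u] cas_last[of u p u] assms(2) by auto
  then obtain e where "e \<in> set p" "v = snd e"
    by blast
  then show ?thesis
    using \<open>set p \<subseteq> parcs G\<close> by (intro bexI[of _ "fst e"]) auto
qed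

text \<open>The orbit of \<open>v\<close> stays in the finite set \<open>S\<close>, so it repeats;
  by injectivity it returns to \<open>v\<close> itself. The orbit up to the first return is the
  cycle.\<close>

lemma determination_cycle:
  assumes "finite S" "S \<subseteq> pverts G" "s ` S \<subseteq> S" "inj_on s S" "v \<in> S"
    and det: "\<And>u. u \<in> S \<Longrightarrow> determines G u (s u)"
  obtains p where "pre_digraph.cycle (with_proj G) p" "fst ` set p \<subseteq> S"
    "s ` fst ` set p \<subseteq> fst ` set p"
proof -
  define f where "f i = (s ^^ i) v" for i
  have f_Suc: "f (Suc i) = s (f i)" for i
    by (simp add: f_def)
  have f_S: "f i \<in> S" for i
    by (induction i) (use assms(3,5) in \<open>auto simp: f_Suc, simp add: f_def\<close>)
  \<comment> \<open>Cancelling \<open>s\<close> repeatedly moves a coincidence back to index 0, so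
    the orbit has no pre-period.\<close>
  have shift_back: "f (i + k) = f i \<Longrightarrow> f k = f 0" for i k
  proof (induction i)
    case (Suc i)
    then show ?case using assms(4) f_S by (auto simp: f_Suc dest: inj_onD)
  qed simp
  have "\<not> inj f"
    using f_S assms(1) by (meson finite_imageD finite_subset image_subsetI infinite_UNIV_nat)
  then obtain i j where "f i = f j" "i < j"
    unfolding inj_def by (metis linorder_neqE_nat)
  then have ex: "\<exists>k. 0 < k \<and> f k = f 0"
    using shift_back[of i "j - i"] by (intro exI[of _ "j - i"]) auto
  define m where "m = (LEAST k. 0 < k \<and> f k = f 0)"
  have m: "0 < m" "f m = f 0"
    using LeastI_ex[OF ex] by (auto simp: m_def)
  have m_least: "\<not> (0 < k \<and> f k = f 0)" if "k < m" for k
    using that not_less_Least unfolding m_def by blast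
  \<comment> \<open>\<open>pre_digraph.cycle\<close> asks for distinctness after dropping the first
    vertex, that is, of the heads \<open>f 1, ..., f m\<close>; hence the range starts at 1.\<close>
  have inj_f: "inj_on f {1..<Suc m}"
  proof (rule linorder_inj_onI')
    fix i j assume "i \<in> {1..<Suc m}" "j \<in> {1..<Suc m}" "i < j"
    then show "f i \<noteq> f j"
      using shift_back[of i "j - i"] m_least[of "j - i"] by auto
  qed
  define p where "p = map (\<lambda>i. (f i, f (Suc i))) [0..<m]"
  have cas: "pcas v p v"
    using cas_funpow[where s = s and k = 0 and v = v and m = m] m(2) by (simp add: p_def f_def)
  have tails: "fst ` set p = f ` {0..<m}"
    by (simp add: p_def image_image)
  have "map snd p = map f [1..<Suc m]"
    by (simp add: p_def map_Suc_upt[symmetric] del: upt_Suc)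
  then have dist: "distinct (map snd p)"
    using inj_f by (simp add: distinct_map del: upt_Suc)
  have verts: "pawalk_verts u q = u # map snd q"
    if "pcas u q w" for u w :: 'a and q
    using that by (induction q arbitrary: u)
      auto
  have "set p \<subseteq> parcs G"
    using determines_arc[OF det[OF f_S]] by (auto simp: p_def f_Suc)
  then have "pre_digraph.cycle (with_proj G) p"
    using cas dist verts[OF cas] m(1) assms(2,5)
    by (auto simp: pre_digraph.cycle_def pre_digraph.awalk_def p_def
      cas_with_proj_eq awalk_verts_with_proj_eq)
  moreover have "s ` fst ` set p \<subseteq> fst ` set p"
  proof -
    have "f (Suc i) \<in> f ` {0..<m}" if "i < m" for i
      using that m by (cases "Suc i = m") auto
    then show ?thesis
      by (auto simp: tails f_Suc)
  qed
  moreover have "fst ` set p \<subseteq> S"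
    using f_S tails by auto
  ultimately show ?thesis
    using that by presburger
qed

lemma determination_chain_to_observable:
  assumes "finite (pverts G)" "property_P1 G D" "property_P2 G D" "v \<in> pverts G"
  shows "\<exists>d \<in> D. (determines G)\<^sup>*\<^sup>* v d"
proof (rule ccontr)
  assume no_chain: "\<not> ?thesis"
  define S where "S = {u \<in> pverts G. \<not> (\<exists>d \<in> D. (determines G)\<^sup>*\<^sup>* u d)}"
  have S_closed: "w \<in> S" if "u \<in> S" "determines G u w" for u w
    using that converse_rtranclp_into_rtranclp[of "determines G" u w]
    by (auto simp: S_def determines_def[of G u w])
  \<comment> \<open>\<open>P1\<close> applies to all of \<open>S\<close>: by chains of length zero,
    \<open>S\<close> contains no vertex of \<open>D\<close>.\<close>
  have "\<forall>u \<in> S. \<exists>w. determines G u w"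
    using assms(2) by (force simp: S_def property_P1_def determines_def)
  then obtain s where s: "\<And>u. u \<in> S \<Longrightarrow> determines G u (s u)"
    by metis
  have fin: "finite S" and sub: "S \<subseteq> pverts G"
    using assms(1) by (auto simp: S_def)
  have into: "s ` S \<subseteq> S"
    using S_closed s by blast
  have inj: "inj_on s S"
    by (rule inj_onI) (metis s determines_unique)
  have "v \<in> S"
    using no_chain assms(4) by (simp add: S_def)
  then obtain p where p: "pre_digraph.cycle (with_proj G) p" "fst ` set p \<subseteq> S"
    "s ` fst ` set p \<subseteq> fst ` set p"
    using determination_cycle[OF fin sub into inj _ s] by blast
  have "S \<inter> D = {}"
    by (auto simp: S_def)
  then have "fst ` set p \<subseteq> pverts G - D"
    using p(2) sub by blast
  then obtain w c where w: "w \<notin> fst ` set p" "c \<in> fst ` set p" "determines G c w"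
    using assms(3) p(1) unfolding property_P2_def determines_def by (metis DiffD1 DiffD2)
  then have "w \<in> S"
    using S_closed p(2) by blast
  \<comment> \<open>Surjectivity of \<open>s\<close> on \<open>S\<close> gives \<open>w\<close> a
    preimage, which must be \<open>c\<close>, the only vertex determining \<open>w\<close>. As
    \<open>s\<close> maps the cycle into itself, \<open>w\<close> would lie on it.\<close>
  then have "w \<in> s ` S"
    using endo_inj_surj[OF fin into inj] by simp
  then obtain u where "u \<in> S" "w = s u"
    by blast
  then have "w = s c"
    using s[of u] determines_unique[OF w(3), of u] by simp
  then show False
    using p(3) w by blast
qed

section \<open>Sufficiency: propagation of differences along chains\<close>

lemma in_neighbors_dependency_graph:
  "i \<in> nodes B \<Longrightarrow> in_neighbors (dependency_graph B) i = nbrs B i"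
  by (auto simp: mem_in_neighbors_iff dependency_graph_def)

lemma pverts_dependency_graph [simp]: "pverts (dependency_graph B) = nodes B"
  by (simp add: dependency_graph_def)

text \<open>A Boolean function that depends on its only argument is the identity or the negation,
  hence injective.\<close>

lemma depends_on_singleton_neq:
  assumes "depends_on {u} g u" "x u \<noteq> x' u"
  shows "g (restrict x {u}) \<noteq> g (restrict x' {u})"
proof -
  obtain z z' where z: "z \<in> {u} \<rightarrow>\<^sub>E UNIV" "z' \<in> {u} \<rightarrow>\<^sub>E UNIV" "g z \<noteq> g z'"
    using assms(1) by (auto simp: depends_on_def)
  have eq: "y = restrict x {u}" if "y \<in> {u} \<rightarrow>\<^sub>E UNIV" "y u = x u" for x y :: "nat \<Rightarrow> bool"
    using that by (auto simp: fun_eq_iff PiE_def extensional_def)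
  have "z u \<noteq> z' u"
    using z eq by metis
  then show ?thesis
    using z eq[of z x] eq[of z x'] eq[of z' x] eq[of z' x'] assms(2) by metis
qed

lemma determines_step_neq:
  assumes "boolean_network B" "determines (dependency_graph B) u w" "x u \<noteq> x' u"
  shows "step B x w \<noteq> step B x' w"
proof -
  have w: "w \<in> nodes B" "nbrs B w = {u}"
    using assms(2) in_neighbors_dependency_graph[of w B] by (auto simp: determines_def)
  then have "depends_on {u} (dyn B w) u"
    using assms(1) by (force simp: boolean_network_def minimally_represented_def)
  then show ?thesis
    using depends_on_singleton_neq[where x = x and x' = x'] assms(3) w by (simp add: step_def)
qed

text \<open>Each link of the chain costs one time step. The states are generalized because the
  induction hypothesis is applied to their successors.\<close>

lemma determination_chain_trajectory_neq:
  assumes "boolean_network B" "(determines (dependency_graph B))\<^sup>*\<^sup>* v d" "x v \<noteq> x' v"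
  shows "\<exists>k. trajectory B x k d \<noteq> trajectory B x' k d"
  using assms(2,3)
proof (induction arbitrary: x x' rule: converse_rtranclp_induct)
  case base
  then show ?case by (intro exI[of _ 0]) (simp add: trajectory_def)
next
  case (step v w)
  have "step B x w \<noteq> step B x' w"
    using determines_step_neq[where x = x and x' = x', OF assms(1) step.hyps(1) step.prems] .
  then obtain k where "trajectory B (step B x) k d \<noteq> trajectory B (step B x') k d"
    using step.IH[of "step B x" "step B x'"] by auto
  then show ?case
    by (intro exI[of _ "Suc k"]) (simp add: trajectory_def funpow_Suc_right del: funpow.simps)
qed

lemma properties_imp_observable:
  assumes "boolean_network B"
    "property_P1 (dependency_graph B) (obs_nodes B)"
    "property_P2 (dependency_graph B) (obs_nodes B)"
  shows "observable B"
  unfolding observable_def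
proof (intro ballI impI)
  fix x x' assume x: "x \<in> states B" "x' \<in> states B" "x \<noteq> x'"
  then obtain v where v: "v \<in> nodes B" "x v \<noteq> x' v"
    using PiE_ext[of x "nodes B" "\<lambda>_. UNIV" x'] by (auto simp: states_def)
  obtain d where d: "d \<in> obs_nodes B" "(determines (dependency_graph B))\<^sup>*\<^sup>* v d"
    using determination_chain_to_observable[OF _ assms(2,3), of v] v(1)
    by (auto simp: nodes_def)
  then obtain k where k: "trajectory B x k d \<noteq> trajectory B x' k d"
    using determination_chain_trajectory_neq[where x = x and x' = x', OF assms(1) d(2) v(2)]
    by auto
  have "output_at B x k d \<noteq> output_at B x' k d"
    using k d(1) by (simp add: output_at_def)
  then have "output_at B x k \<noteq> output_at B x' k"
    by auto
  then show "\<exists>k. output_at B x k \<noteq> output_at B x' k" ..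
qed

section \<open>Essential dependence of the functions used in counterexamples\<close>

lemma depends_onI:
  assumes "j \<in> A" "g (restrict (z(j := True)) A) \<noteq> g (restrict (z(j := False)) A)"
  shows "depends_on A g j"
proof -
  have "\<forall>l \<in> A - {j}. restrict (z(j := True)) A l = restrict (z(j := False)) A l"
    by simp
  moreover have "restrict (z(j := b)) A \<in> A \<rightarrow>\<^sub>E UNIV" for b
    by simp
  ultimately show ?thesis
    using assms(2) unfolding depends_on_def by blast
qed

lemma minimally_represented_conj: "minimally_represented A (\<lambda>z. \<forall>j \<in> A. z j)"
  unfolding minimally_represented_def
  by (intro ballI depends_onI[where z = "\<lambda>_. True"]) auto

lemma minimally_represented_disj: "minimally_represented A (\<lambda>z. \<exists>j \<in> A. z j)"
  unfolding minimally_represented_def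
  by (intro ballI depends_onI[where z = "\<lambda>_. False"]) auto

text \<open>Flipping one entry of the all-true vector breaks equality as soon as a second argument
  exists. On a singleton the function is constantly true, which is why that case is
  excluded.\<close>

lemma minimally_represented_all_equal:
  assumes "\<And>j. A \<noteq> {j}"
  shows "minimally_represented A (\<lambda>z. \<forall>i \<in> A. \<forall>j \<in> A. z i = z j)"
  unfolding minimally_represented_def
proof (intro ballI depends_onI[where z = "\<lambda>_. True"])
  fix j assume "j \<in> A"
  then obtain i where "i \<in> A" "i \<noteq> j"
    using assms by blast
  then show "(\<forall>i \<in> A. \<forall>l \<in> A. restrict ((\<lambda>_. True)(j := True)) A i = restrict ((\<lambda>_. True)(j := True)) A l)
    \<noteq> (\<forall>i \<in> A. \<forall>l \<in> A. restrict ((\<lambda>_. True)(j := False)) A i = restrict ((\<lambda>_. True)(j := False)) A l)"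
    using \<open>j \<in> A\<close> by fastforce
qed

section \<open>Necessity: unobservable networks on the same graph\<close>

lemma structurally_observableD:
  assumes "boolean_network B" "structurally_observable B"
    "\<And>i. i \<in> nodes B \<Longrightarrow> minimally_represented (nbrs B i) (g i)"
  shows "observable (B\<lparr>dyn := g\<rparr>)"
proof -
  have "boolean_network (B\<lparr>dyn := g\<rparr>)"
    using assms(1,3) by (simp add: boolean_network_def nodes_def)
  moreover have "structurally_equivalent B (B\<lparr>dyn := g\<rparr>)"
    by (simp add: structurally_equivalent_def dependency_graph_def nodes_def)
  ultimately show ?thesis
    using assms(2) by (simp add: structurally_observable_def)
qed

lemma structurally_observable_imp_P1:
  assumes "boolean_network B" "structurally_observable B"
  shows "property_P1 (dependency_graph B) (obs_nodes B)"
proof (rule ccontr)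
  assume "\<not> ?thesis"
  then obtain v where v: "v \<in> nodes B" "v \<notin> obs_nodes B"
    and no_det: "\<And>i. i \<in> nodes B \<Longrightarrow> nbrs B i \<noteq> {v}"
    by (auto simp: property_P1_def in_neighbors_dependency_graph)
  define B' where "B' = B\<lparr>dyn := \<lambda>i z. \<forall>j \<in> nbrs B i. z j\<rparr>"
  have sel: "nodes B' = nodes B" "obs_nodes B' = obs_nodes B" "nbrs B' = nbrs B"
    "dyn B' = (\<lambda>i z. \<forall>j \<in> nbrs B i. z j)"
    by (simp_all add: B'_def nodes_def obs_nodes_def)
  have obs: "observable B'"
    unfolding B'_def
    by (rule structurally_observableD[OF assms]) (rule minimally_represented_conj)
  define x where "x = (\<lambda>i \<in> nodes B. False)"
  define x' where "x' = (\<lambda>i \<in> nodes B. i = v)"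
  have sub: "nbrs B i \<subseteq> nodes B" if "i \<in> nodes B" for i
    using assms(1) that by (simp add: boolean_network_def)
  \<comment> \<open>The conjunction holds at \<open>x\<close> only for an empty neighborhood, and at
    \<open>x'\<close> only for one contained in \<open>{v}\<close>. These differ only for
    \<open>{v}\<close>, which \<open>no_det\<close> rules out.\<close>
  have "(\<forall>j \<in> nbrs B i. x j) = (\<forall>j \<in> nbrs B i. x' j)" if i: "i \<in> nodes B" for i
    using no_det[OF i] sub[OF i] by (auto simp: x_def x'_def)
  then have step_eq: "step B' x = step B' x'"
    by (auto simp: step_def sel fun_eq_iff)
  have same: "output_at B' x k = output_at B' x' k" for k
  proof (cases k)
    case 0
    then show ?thesis
      using v(2) by (auto simp: output_at_def trajectory_def x_def x'_def sel restrict_def)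
  next
    case (Suc m)
    then show ?thesis
      using step_eq by (simp add: output_at_def trajectory_def funpow_Suc_right del: funpow.simps)
  qed
  have "x \<in> states B'" "x' \<in> states B'"
    by (auto simp: states_def sel x_def x'_def)
  moreover have "x \<noteq> x'"
  proof
    assume "x = x'"
    then have "x v = x' v"
      by simp
    then show False
      using v(1) by (auto simp: x_def x'_def)
  qed
  ultimately have "\<exists>k. output_at B' x k \<noteq> output_at B' x' k"
    using obs unfolding observable_def by metis
  then show False
    using same by simp
qed

lemma trajectory_fixed_point: "step B x = x \<Longrightarrow> trajectory B x k = x"
  by (induction k) (simp_all add: trajectory_def)

lemma structurally_observable_imp_P2:
  assumes "boolean_network B" "structurally_observable B"
  shows "property_P2 (dependency_graph B) (obs_nodes B)"
proof (rule ccontr)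
  assume "\<not> ?thesis"
  then obtain p where p: "pre_digraph.cycle (with_proj (dependency_graph B)) p"
    and p_sub: "fst ` set p \<subseteq> nodes B - obs_nodes B"
    and "\<not> (\<exists>i \<in> nodes B - fst ` set p. \<exists>c \<in> fst ` set p.
      in_neighbors (dependency_graph B) i = {c})"
    unfolding property_P2_def pverts_dependency_graph by blast
  then have p_det: "nbrs B i \<noteq> {c}" if "i \<in> nodes B - fst ` set p" "c \<in> fst ` set p" for i c
    using that in_neighbors_dependency_graph[of i B] by (metis DiffD1)
  define C where "C = fst ` set p"
  have C_sub: "C \<subseteq> nodes B" and C_obs: "C \<inter> obs_nodes B = {}"
    using p_sub by (auto simp: C_def)
  have "p \<noteq> []"
    using p by (auto simp: pre_digraph.cycle_def)
  then obtain c where c: "c \<in> C"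
    by (cases p) (auto simp: C_def)
  have pred: "nbrs B i \<inter> C \<noteq> {}" if "i \<in> C" for i
    using cycle_vertex_has_pred[OF p] that by (auto simp: C_def dependency_graph_def)
  have det: "nbrs B i \<noteq> {j}" if "i \<in> nodes B" "i \<notin> C" "nbrs B i \<subseteq> C" for i j
    using p_det that by (auto simp: C_def)
  \<comment> \<open>Inside \<open>C\<close> a conjunction copies the value of \<open>C\<close>,
    since some in-neighbor lies in \<open>C\<close>. Outside \<open>C\<close> the value must be true
    in both states: if all in-neighbors are in \<open>C\<close>, they agree with each other, so the
    equality test succeeds; otherwise an in-neighbor outside \<open>C\<close> is true and makes the
    disjunction true.\<close>
  define g :: "nat \<Rightarrow> (nat \<Rightarrow> bool) \<Rightarrow> bool" where "g i =
      (if i \<in> C then (\<lambda>z. \<forall>j \<in> nbrs B i. z j)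
       else if nbrs B i \<subseteq> C then (\<lambda>z. \<forall>j \<in> nbrs B i. \<forall>l \<in> nbrs B i. z j = z l)
       else (\<lambda>z. \<exists>j \<in> nbrs B i. z j))" for i
  define B' where "B' = B\<lparr>dyn := g\<rparr>"
  have sel: "nodes B' = nodes B" "obs_nodes B' = obs_nodes B" "nbrs B' = nbrs B" "dyn B' = g"
    by (simp_all add: B'_def nodes_def obs_nodes_def)
  have "minimally_represented (nbrs B i) (g i)" if "i \<in> nodes B" for i
    using minimally_represented_conj minimally_represented_disj
      minimally_represented_all_equal[of "nbrs B i"] det[OF that]
    by (simp add: g_def)
  then have obs: "observable B'"
    unfolding B'_def by (rule structurally_observableD[OF assms])
  define x where "x = (\<lambda>i \<in> nodes B. True)"
  define x' where "x' = (\<lambda>i \<in> nodes B. i \<notin> C)"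
  have sub: "nbrs B i \<subseteq> nodes B" if "i \<in> nodes B" for i
    using assms(1) that by (simp add: boolean_network_def)
  have g_x: "g i (restrict x (nbrs B i))" if i: "i \<in> nodes B" for i
    using sub[OF i] by (auto simp: g_def x_def subset_iff)
  have g_x': "g i (restrict x' (nbrs B i)) \<longleftrightarrow> i \<notin> C" if i: "i \<in> nodes B" for i
    using sub[OF i] pred[of i] by (auto simp: g_def x'_def subset_iff)
  have "step B' x = x" "step B' x' = x'"
    using g_x g_x' by (auto simp: step_def sel x_def x'_def fun_eq_iff)
  then have same: "output_at B' x k = output_at B' x' k" for k
    using C_obs by (auto simp: output_at_def trajectory_fixed_point sel x_def x'_def fun_eq_iff)
  have "x \<in> states B'" "x' \<in> states B'"
    by (auto simp: states_def sel x_def x'_def)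
  moreover have "x \<noteq> x'"
  proof
    assume "x = x'"
    then have "x c = x' c"
      by simp
    then show False
      using c C_sub by (auto simp: x_def x'_def)
  qed
  ultimately have "\<exists>k. output_at B' x k \<noteq> output_at B' x' k"
    using obs unfolding observable_def by metis
  then show False
    using same by simp
qed

theorem theorem1:
  fixes B :: bool_net
  assumes "boolean_network B"
  shows "structurally_observable B \<longleftrightarrow>
    property_P1 (dependency_graph B) (obs_nodes B) \<and>
    property_P2 (dependency_graph B) (obs_nodes B)"
proof (intro iffI conjI)
  assume "structurally_observable B"
  then show "property_P1 (dependency_graph B) (obs_nodes B)"
    "property_P2 (dependency_graph B) (obs_nodes B)"
    using assms by (simp_all add: structurally_observable_imp_P1 structurally_observable_imp_P2)
next
  assume P: "property_P1 (dependency_graph B) (obs_nodes B) \<and>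
    property_P2 (dependency_graph B) (obs_nodes B)"
  \<comment> \<open>Both properties refer only to the graph and the observed nodes, which
    \<open>B'\<close> shares with \<open>B\<close>.\<close>
  have "observable B'" if "boolean_network B'" "structurally_equivalent B B'" for B'
  proof -
    have "dependency_graph B' = dependency_graph B" "obs_nodes B' = obs_nodes B"
      using that(2) by (simp_all add: structurally_equivalent_def obs_nodes_def)
    then show ?thesis
      using properties_imp_observable[OF that(1)] P by simp
  qed
  then show "structurally_observable B"
    by (simp add: structurally_observable_def)
qed

end
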